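(* Let $k\geqslant 1$, $n\in\mathbb{Z}_{\geqslant 0}$, let $\overrightarrow{m}=(m_1,\ldots,m_k)$ be a multi-index of non-negative integers with $m=m_1+\ldots+m_k\neq 0$, and suppose that $n\geqslant\max\{m_j: 1\leqslant j\leqslant k\}$. Put $n_j=n+m-m_j$. Let $b^j_l$ ($1\leqslant j\leqslant k$, $l\geqslant 1$) be real numbers such that each series $\sum_{l=1}^\infty b^j_l U_l(x)$, where $U_l(x)=\frac{1}{\sqrt{1-x^2}}\sin(l\arccos x)$, converges for all $x\in[-1,1]$. Consider the associated systems ${\bf f^2}=(f^2_1,\ldots,f^2_k)$ and ${\bf f^{t2}}=(f^{t2}_1,\ldots,f^{t2}_k)$ of power and trigonometric series $$f^2_j(z)=\sum_{l=1}^\infty b^j_l z^l,\qquad f^{t2}_j(x)=\sum_{l=1}^\infty b^j_l\sin lx .$$ Then for the existence of trigonometric Hermite--Jacobi approximations $\{\widehat{\pi}^t_j(x;{\bf f^{t2}})\}_{j=1}^k$ for the multi-index $(n,\overrightarrow{m})$ and the system ${\bf f^{t2}}$ it is sufficient that the following conditions hold: 1) there exist (algebraic) Hermite--Jacobi approximations $\widehat{\pi}_j(z;{\bf f^2})=\widehat{P}_j(z;{\bf f^2})/\widehat{Q}_m(z;{\bf f^2})$, $j=1,\ldots,k$, for the multi-index $(n,\overrightarrow{m})$ and the system ${\bf f^2}$; 2) each power series $f^2_j$ has radius of convergence $R^2_j>1$; 3) the rational fractions $\widehat{\pi}_j(z;{\bf f^2})$, $j=1,\ldots,k$, have no poles in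 $\overline{D}=\{z:|z|\leqslant 1\}$. Moreover, if conditions 1)--3) are satisfied, then, with the appropriate normalization, the denominator $\widehat{Q}^t_m$ and numerators $\widehat{P}^t_j$ of the trigonometric Hermite--Jacobi approximations $\widehat{\pi}^t_j=\widehat{P}^t_j/\widehat{Q}^t_m$ satisfy, for all $j=1,\ldots,k$, $$\widehat{Q}^t_m(x;{\bf f^{t2}})=\widehat{Q}_m(e^{ix};{\bf f^2})\cdot\overline{\widehat{Q}_m(e^{ix};{\bf f^2})}=\sum_{l=0}^m \widehat{q}_l\cos lx,$$ $$\widehat{P}^t_j(x;{\bf f^{t2}})=\mathrm{Im}\left\{\widehat{P}_j(e^{ix};{\bf f^2})\cdot\overline{\widehat{Q}_m(e^{ix};{\bf f^2})}\right\}=\sum_{l=0}^{n_j}\widehat{p}^j_l\sin lx,$$ $$f^{t2}_j(x)-\widehat{\pi}^t_j(x;{\bf f^{t2}})=\sum_{l=n+m+1}^\infty \widehat{d}^j_l\sin lx,$$ where $\widehat{q}_l$, $\widehat{p}^j_l$, $\widehat{d}^j_l$ are real numbers.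
   Context: Throughout, $O(z^p)$ denotes a power series of the form $c_1z^p+c_2z^{p+1}+\ldots$, and $n_j=n+m-m_j$ with $m=m_1+\ldots+m_k$. The functions $U_l$ (Chebyshev polynomials of the second kind, indexed so that $U_l$ has degree $l-1$) are polynomials, with values at $x=\pm1$ understood accordingly. (Algebraic) Hermite--Jacobi approximations. For a system ${\bf f}=(f_1,\ldots,f_k)$ of power series in $z$, rational functions $\widehat{\pi}_j(z;{\bf f})=\widehat{P}_j(z;{\bf f})/\widehat{Q}_m(z;{\bf f})$, $j=1,\ldots,k$, with a common denominator, where $\widehat{Q}_m$ (not identically zero) and $\widehat{P}_j$ are algebraic polynomials of degree at most $m$ and $n_j$ respectively, are called Hermite--Jacobi approximations for the multi-index $(n,\overrightarrow{m})$ and the system ${\bf f}$ if $f_j(z)-\widehat{P}_j(z;{\bf f})/\widehat{Q}_m(z;{\bf f})=O(z^{n+m+1})$ for $j=1,\ldots,k$. They may fail to exist. When the coefficients of the series are real, the polynomials $\widehat{Q}_m,\widehat{P}_j$ are taken with real coefficients. Trigonometric Hermite--Jacobi approximations. For a system ${\bf f^t}=(f^t_1,\ldots,f^t_k)$ of trigonometric series with real coefficients convergent for all $x\in\mathbb{R}$, trigonometric rational functions $\widehat{\pi}^t_j(x;{\bf f^t})=\widehat{P}^t_j(x;{\bf f^t})/\widehat{Q}^t_m(x;{\bf f^t})$, $j=1,\ldots,k$, with a common denominator, where $\widehat{Q}^t_m$ (not identically zero) and $\widehat{P}^t_j$ are trigonometric polynomials of degree at most $m$ and $n_j$ respectively,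 are called trigonometric Hermite--Jacobi approximations for the multi-index $(n,\overrightarrow{m})$ and the system ${\bf f^t}$ if $$f^t_j(x)-\frac{\widehat{P}^t_j(x;{\bf f^t})}{\widehat{Q}^t_m(x;{\bf f^t})}=\sum_{l=n+m+1}^\infty(\widehat{a}^j_l\cos lx+\widehat{b}^j_l\sin lx),\quad j=1,\ldots,k.$$ Quotients are regarded as (trigonometric) rational functions, i.e. removable singularities are removed. *)

theory Defs
  imports "HOL-Complex_Analysis.Complex_Analysis"
begin

text \<open>
  The index is shifted: \<open>U\<^sub>l\<close> has degree \<open>l - 1\<close>.  The lemmas below show that this is the
  polynomial extending \<open>sin (l arccos x) / sqrt (1 - x\<^sup>2)\<close> from \<open>(-1, 1)\<close> to the whole line.
\<close>

fun cheb_U :: "nat \<Rightarrow> real poly" where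
  "cheb_U 0 = 0"
| "cheb_U (Suc 0) = 1"
| "cheb_U (Suc (Suc l)) = [:0, 2:] * cheb_U (Suc l) - cheb_U l"

lemma sin_mult_cheb_U: "sin t * poly (cheb_U l) (cos t) = sin (real l * t)"
proof (induction l rule: cheb_U.induct)
  case (3 l)
  have "sin (real (Suc (Suc l)) * t) + sin (real l * t) = 2 * cos t * sin (real (Suc l) * t)"
    using sin_times_cos[of "real (Suc l) * t" t]
    by (simp add: algebra_simps)
  with 3 show ?case
    by (simp add: algebra_simps)
qed auto

lemma poly_cheb_U:
  assumes "-1 < x" "x < 1"
  shows "poly (cheb_U l) x = sin (real l * arccos x) / sqrt (1 - x\<^sup>2)"
proof -
  have "x\<^sup>2 < 1"
    using assms by (simp add: abs_square_less_1)
  then show ?thesis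
    using sin_mult_cheb_U[of "arccos x" l] assms
    by (simp add: sin_arccos field_simps)
qed

lemma degree_cheb_U: "degree (cheb_U (Suc l)) = l"
proof -
  have "cheb_U (Suc l) \<noteq> 0 \<and> degree (cheb_U (Suc l)) = l \<and> degree (cheb_U l) \<le> l - 1"
  proof (induction l)
    case (Suc l)
    have "degree ([:0, 2:] * cheb_U (Suc l)) = Suc l"
      using Suc by (subst degree_mult_eq) auto
    moreover have "degree (cheb_U l) < Suc l"
      using Suc by linarith
    ultimately have "degree ([:0, 2:] * cheb_U (Suc l) - cheb_U l) = Suc l"
      using degree_add_eq_left[of "- cheb_U l" "[:0, 2:] * cheb_U (Suc l)"]
      by (simp del: mult_pCons_left)
    then have "degree (cheb_U (Suc (Suc l))) = Suc l"
      by (simp only: cheb_U.simps)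
    moreover from this have "cheb_U (Suc (Suc l)) \<noteq> 0"
      by (metis degree_0 nat.distinct(1))
    ultimately show ?case
      using Suc by (simp del: cheb_U.simps)
  qed auto
  then show ?thesis by simp
qed

text \<open>
  Multi-indices are functions on \<open>{1..k}\<close>; values outside this set are irrelevant.
\<close>

definition mi_total :: "nat \<Rightarrow> (nat \<Rightarrow> nat) \<Rightarrow> nat" where
  "mi_total k m = (\<Sum>j=1..k. m j)"

definition num_degree :: "nat \<Rightarrow> nat \<Rightarrow> (nat \<Rightarrow> nat) \<Rightarrow> nat \<Rightarrow> nat" where
  "num_degree k n m j = n + mi_total k m - m j"

text \<open>
  The expansion at 0 of a rational function is taken in the field of formal Laurent series,
  because the denominator may vanish at 0.  A Laurent series is \<open>O(z\<^sup>p)\<close> if it has the form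
  \<open>c\<^sub>1 z\<^sup>p + c\<^sub>2 z\<^sup>p\<^sup>+\<^sup>1 + \<dots>\<close>.
\<close>

definition poly_to_fls :: "'a::field poly \<Rightarrow> 'a fls" where
  "poly_to_fls p = fps_to_fls (fps_of_poly p)"

definition fls_bigo_power :: "nat \<Rightarrow> 'a::zero fls \<Rightarrow> bool" where
  "fls_bigo_power p g \<longleftrightarrow> (\<forall>i < int p. fls_nth g i = 0)"

definition hermite_jacobi ::
  "nat \<Rightarrow> nat \<Rightarrow> (nat \<Rightarrow> nat) \<Rightarrow> (nat \<Rightarrow> 'a::field fps) \<Rightarrow> (nat \<Rightarrow> 'a poly) \<Rightarrow> 'a poly \<Rightarrow> bool"
where
  "hermite_jacobi k n m f P Q \<longleftrightarrow>
     Q \<noteq> 0 \<and> degree Q \<le> mi_total k m \<and>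
     (\<forall>j\<in>{1..k}. degree (P j) \<le> num_degree k n m j \<and>
        fls_bigo_power (n + mi_total k m + 1)
          (fps_to_fls (f j) - poly_to_fls (P j) / poly_to_fls Q))"

definition cpoly :: "real poly \<Rightarrow> complex \<Rightarrow> complex" where
  "cpoly p z = poly (map_poly complex_of_real p) z"

definition trig_poly :: "nat \<Rightarrow> (real \<Rightarrow> real) \<Rightarrow> bool" where
  "trig_poly d T \<longleftrightarrow>
     (\<exists>a b. \<forall>x. T x = (\<Sum>l=0..d. a l * cos (real l * x) + b l * sin (real l * x)))"

text \<open>
  The value at \<open>x\<close> of the trigonometric rational function \<open>P / Q\<close>, removable singularities being
  removed.  It is meaningful only when \<open>P / Q\<close> has no pole at \<open>x\<close>, i.e. when the limit exists.
\<close>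

definition trig_regular :: "(real \<Rightarrow> real) \<Rightarrow> (real \<Rightarrow> real) \<Rightarrow> real \<Rightarrow> bool" where
  "trig_regular P Q x \<longleftrightarrow> (\<exists>v. ((\<lambda>y. P y / Q y) \<longlongrightarrow> v) (at x))"

definition trig_quot :: "(real \<Rightarrow> real) \<Rightarrow> (real \<Rightarrow> real) \<Rightarrow> real \<Rightarrow> real" where
  "trig_quot P Q x = Lim (at x) (\<lambda>y. P y / Q y)"

text \<open>
  Here \<open>f j\<close> is the sum of the \<open>j\<close>-th (everywhere convergent) trigonometric series.
\<close>

definition trig_hermite_jacobi ::
  "nat \<Rightarrow> nat \<Rightarrow> (nat \<Rightarrow> nat) \<Rightarrow> (nat \<Rightarrow> real \<Rightarrow> real) \<Rightarrow> (nat \<Rightarrow> real \<Rightarrow> real) \<Rightarrow>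
     (real \<Rightarrow> real) \<Rightarrow> bool"
where
  "trig_hermite_jacobi k n m f P Q \<longleftrightarrow>
     (\<exists>x. Q x \<noteq> 0) \<and> trig_poly (mi_total k m) Q \<and>
     (\<forall>j\<in>{1..k}. trig_poly (num_degree k n m j) (P j) \<and>
        (\<forall>x. trig_regular (P j) Q x) \<and>
        (\<exists>a b. \<forall>x. (\<lambda>i. let l = n + mi_total k m + 1 + i in
                         a l * cos (real l * x) + b l * sin (real l * x))
                     sums (f j x - trig_quot (P j) Q x)))"

definition power_system :: "(nat \<Rightarrow> nat \<Rightarrow> real) \<Rightarrow> nat \<Rightarrow> real fps" where
  "power_system b j = Abs_fps (\<lambda>l. if l = 0 then 0 else b j l)"

definition sine_system :: "(nat \<Rightarrow> nat \<Rightarrow> real) \<Rightarrow> nat \<Rightarrow> real \<Rightarrow> real" where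
  "sine_system b j x = (\<Sum>l. b j (Suc l) * sin (real (Suc l) * x))"

lemma summable_sine_system:
  assumes "\<And>y. y \<in> {-1..1} \<Longrightarrow> summable (\<lambda>l. b j (Suc l) * poly (cheb_U (Suc l)) y)"
  shows "summable (\<lambda>l. b j (Suc l) * sin (real (Suc l) * x))"
proof -
  have "summable (\<lambda>l. sin x * (b j (Suc l) * poly (cheb_U (Suc l)) (cos x)))"
    by (intro summable_mult assms) auto
  then show ?thesis
    by (simp only: sin_mult_cheb_U[symmetric] mult.left_commute)
qed

end

theory Submission
  imports Defs "HOL-Computational_Algebra.Field_as_Ring"
    "HOL-Computational_Algebra.Polynomial_Factorial"
begin

text \<open>
  Write \<open>M\<close> for the total order of the multi-index.  On the unit circle, where \<open>z = cis x\<close>, a power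
  series with real coefficients has its sine series as imaginary part.  So the trigonometric problem
  for \<open>\<Sum> b\<^sub>l sin (l x)\<close> is the imaginary part of the algebraic problem for \<open>\<Sum> b\<^sub>l z\<^sup>l\<close>, as soon as the
  identity \<open>f - P / Q = E\<close>, with \<open>E\<close> of order at least \<open>n + M + 1\<close>, which is given only formally at the
  origin, holds between convergent series on the unit circle.

  That convergence is what the hypotheses on the radii and the poles provide.  Cancelling the common
  factor of \<open>P\<close> and \<open>Q\<close> leaves a fraction \<open>A / B\<close> in which a zero of \<open>B\<close> in the closed unit disc would be a
  pole; hence \<open>B\<close> has no zero there, and, having only finitely many zeros, none in some larger disc
  (\<open>pole_free_reduced_fraction\<close>).  Hence the expansion of \<open>A / B\<close> at the origin has a radius of
  convergence greater than 1 (\<open>power_series_of_fraction\<close>), and so has \<open>E\<close>.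

  Taking imaginary parts, \<open>Im (P / Q) = Im (P cnj Q) / \<bar>Q\<bar>\<^sup>2\<close>; the numerator and the denominator are
  the trigonometric polynomials sought, and zeros of \<open>Q\<close> on the circle only give removable
  singularities (\<open>tendsto_trig_quotient\<close>).  As for degrees, \<open>P\<^sub>j cnj Q\<close> has frequencies between \<open>-M\<close>
  and \<open>n + M - m\<^sub>j\<close>.  Folding the negative frequencies onto the positive ones keeps the degree at most
  \<open>n + M - m\<^sub>j\<close> because \<open>n \<ge> m\<^sub>j\<close> makes that number at least \<open>M\<close>.
\<close>

section \<open>Products of real polynomials on the unit circle\<close>

lemma cpoly_cis:
  assumes "degree p \<le> d"
  shows "cpoly p (cis x) = (\<Sum>i=0..d. complex_of_real (coeff p i) * cis (real i * x))"
proof -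
  have "cpoly p (cis x) = (\<Sum>i\<le>degree p. complex_of_real (coeff p i) * cis (real i * x))"
    by (simp add: cpoly_def poly_altdef coeff_map_poly Complex.DeMoivre degree_map_poly)
  also have "\<dots> = (\<Sum>i=0..d. complex_of_real (coeff p i) * cis (real i * x))"
    using assms by (intro sum.mono_neutral_left) (auto simp: coeff_eq_0)
  finally show ?thesis .
qed

lemma cpoly_mult_cnj_cis:
  assumes "degree p \<le> d" "degree q \<le> e"
  shows "cpoly p (cis x) * cnj (cpoly q (cis x)) =
    (\<Sum>(i, j)\<in>{0..d} \<times> {0..e}.
       complex_of_real (coeff p i * coeff q j) * cis (real_of_int (int i - int j) * x))"
  unfolding cpoly_cis[OF assms(1)] cpoly_cis[OF assms(2)]
  by (simp add: sum_product sum.cartesian_product cis_cnj cis_mult algebra_simps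
      flip: cis_divide)

text \<open>
  Collects equal frequencies, which turns the double sum of a product into a trigonometric polynomial.
\<close>

lemma sum_group_frequencies:
  fixes c :: "'a \<Rightarrow> real" and \<phi> :: "nat \<Rightarrow> real"
  assumes "finite I" "\<And>i. i \<in> I \<Longrightarrow> h i \<le> d"
  shows "(\<Sum>i\<in>I. c i * \<phi> (h i)) = (\<Sum>l=0..d. (\<Sum>i\<in>{i\<in>I. h i = l}. c i) * \<phi> l)"
proof -
  have "(\<Sum>i\<in>I. c i * \<phi> (h i)) = (\<Sum>l=0..d. \<Sum>i\<in>{i\<in>I. h i = l}. c i * \<phi> (h i))"
    using assms by (intro sum.group[symmetric]) auto
  then show ?thesis
    by (simp add: sum_distrib_right)
qed

lemma cos_int_abs: "cos (real_of_int k * x) = cos (real (nat \<bar>k\<bar>) * x)"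
  by (cases "k \<ge> 0") auto

lemma sin_int_abs:
  "sin (real_of_int k * x) = real_of_int (sgn k) * sin (real (nat \<bar>k\<bar>) * x)"
  by (cases "k = 0"; cases "k > 0") auto

text \<open>
  The coefficients being real, the real part keeps only cosines of the frequencies \<open>i - j\<close>, and
  cosine being even these may be replaced by \<open>\<bar>i - j\<bar> \<le> d\<close>.
\<close>

lemma Re_cpoly_mult_cnj_cosine_polynomial:
  assumes "degree p \<le> d" "degree q \<le> d"
  shows "\<exists>a. \<forall>x. Re (cpoly p (cis x) * cnj (cpoly q (cis x))) = (\<Sum>l=0..d. a l * cos (real l * x))"
proof -
  define I where "I = {0..d} \<times> {0..d}"
  define h where "h = (\<lambda>(i, j). nat \<bar>int i - int j\<bar>)"
  define c where "c = (\<lambda>(i, j). coeff p i * coeff q j)"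
  have "Re (cpoly p (cis x) * cnj (cpoly q (cis x))) =
      (\<Sum>l=0..d. (\<Sum>i\<in>{i\<in>I. h i = l}. c i) * cos (real l * x))" for x
  proof -
    have "Re (cpoly p (cis x) * cnj (cpoly q (cis x))) = (\<Sum>i\<in>I. c i * cos (real (h i) * x))"
      unfolding cpoly_mult_cnj_cis[OF assms] Re_sum I_def
      by (intro sum.cong refl) (auto simp: c_def h_def cos_int_abs simp del: of_int_diff of_nat_nat)
    also have "\<dots> = (\<Sum>l=0..d. (\<Sum>i\<in>{i\<in>I. h i = l}. c i) * cos (real l * x))"
      by (intro sum_group_frequencies) (auto simp: I_def h_def)
    finally show ?thesis .
  qed
  then show ?thesis
    by (intro exI[of _ "\<lambda>l. \<Sum>i\<in>{i\<in>I. h i = l}. c i"] allI)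
qed

text \<open>
  As before, but sine is odd: folding \<open>i - j\<close> onto \<open>\<bar>i - j\<bar>\<close> puts the sign of \<open>i - j\<close> into the coefficient.
\<close>

lemma Im_cpoly_mult_cnj_sine_polynomial:
  assumes "degree p \<le> d" "degree q \<le> d"
  shows "\<exists>a. \<forall>x. Im (cpoly p (cis x) * cnj (cpoly q (cis x))) = (\<Sum>l=0..d. a l * sin (real l * x))"
proof -
  define I where "I = {0..d} \<times> {0..d}"
  define h where "h = (\<lambda>(i, j). nat \<bar>int i - int j\<bar>)"
  define c where "c = (\<lambda>(i, j). coeff p i * coeff q j * real_of_int (sgn (int i - int j)))"
  have "Im (cpoly p (cis x) * cnj (cpoly q (cis x))) =
      (\<Sum>l=0..d. (\<Sum>i\<in>{i\<in>I. h i = l}. c i) * sin (real l * x))" for x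
  proof -
    have "Im (cpoly p (cis x) * cnj (cpoly q (cis x))) = (\<Sum>i\<in>I. c i * sin (real (h i) * x))"
      unfolding cpoly_mult_cnj_cis[OF assms] Im_sum I_def
      by (intro sum.cong refl)
         (auto simp: c_def h_def sin_int_abs mult.assoc simp del: of_int_diff of_nat_nat)
    also have "\<dots> = (\<Sum>l=0..d. (\<Sum>i\<in>{i\<in>I. h i = l}. c i) * sin (real l * x))"
      by (intro sum_group_frequencies) (auto simp: I_def h_def)
    finally show ?thesis .
  qed
  then show ?thesis
    by (intro exI[of _ "\<lambda>l. \<Sum>i\<in>{i\<in>I. h i = l}. c i"] allI)
qed

section \<open>The remainder as a real power series\<close>

text \<open>
  Laurent series enter only because \<open>Q\<close> may vanish at the origin.  Since the remainder has no terms
  of negative order it is a power series, and clearing the denominator gives an identity of power series.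
\<close>

lemma hermite_jacobi_remainder:
  assumes "hermite_jacobi k n m f P Q" "j \<in> {1..k}"
  obtains E where "\<And>i. i < n + mi_total k m + 1 \<Longrightarrow> fps_nth E i = 0"
    "fps_of_poly Q * (f j - E) = fps_of_poly (P j)"
proof -
  define g where "g = fps_to_fls (f j) - poly_to_fls (P j) / poly_to_fls Q"
  have g0: "fls_nth g i = 0" if "i < int (n + mi_total k m + 1)" for i
    using assms that by (auto simp: hermite_jacobi_def fls_bigo_power_def g_def)
  have "fls_subdegree g \<ge> 0"
    using g0 by (intro fls_subdegree_ge0I) auto
  then have E: "fps_to_fls (fls_regpart g) = g"
    by simp
  have "Q \<noteq> 0"
    using assms by (simp add: hermite_jacobi_def)
  then have Q: "poly_to_fls Q \<noteq> 0"
    by (simp add: poly_to_fls_def fps_of_poly_eq_iff[of Q 0, simplified])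
  have "fps_to_fls (fps_of_poly Q * (f j - fls_regpart g)) = poly_to_fls Q * (fps_to_fls (f j) - g)"
    by (simp add: E fls_times_fps_to_fls poly_to_fls_def)
  also have "\<dots> = fps_to_fls (fps_of_poly (P j))"
    using Q by (simp add: g_def poly_to_fls_def)
  finally show ?thesis
    using that[of "fls_regpart g"] g0 by simp
qed

section \<open>Pole-free fractions and their expansions at the origin\<close>

text \<open>
  Convergence up to the unit circle is decided by complex zeros of the denominator, so the real series
  have to be read as complex ones.
\<close>

definition cfps :: "real fps \<Rightarrow> complex fps" where
  "cfps F = Abs_fps (\<lambda>i. complex_of_real (fps_nth F i))"

lemma cfps_nth [simp]: "fps_nth (cfps F) i = complex_of_real (fps_nth F i)"
  by (simp add: cfps_def)

lemma cfps_mult: "cfps (F * G) = cfps F * cfps G"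
  by (simp add: fps_eq_iff fps_mult_nth)

lemma cfps_diff: "cfps (F - G) = cfps F - cfps G"
  by (simp add: fps_eq_iff)

lemma cfps_of_poly: "cfps (fps_of_poly p) = fps_of_poly (map_poly complex_of_real p)"
  by (simp add: fps_eq_iff coeff_map_poly)

lemma fps_conv_radius_cfps [simp]: "fps_conv_radius (cfps F) = fps_conv_radius F"
  by (simp add: fps_conv_radius_def conv_radius_def)

lemma cpoly_mult: "cpoly (p * q) z = cpoly p z * cpoly q z"
proof -
  have "map_poly complex_of_real (p * q) = map_poly complex_of_real p * map_poly complex_of_real q"
    by (simp add: poly_eq_iff coeff_map_poly coeff_mult)
  then show ?thesis by (simp add: cpoly_def)
qed

lemma cpoly_add: "cpoly (p + q) z = cpoly p z + cpoly q z"
proof -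
  have "map_poly complex_of_real (p + q) = map_poly complex_of_real p + map_poly complex_of_real q"
    by (simp add: poly_eq_iff coeff_map_poly)
  then show ?thesis by (simp add: cpoly_def)
qed

lemma finite_cpoly_roots: "p \<noteq> 0 \<Longrightarrow> finite {z. cpoly p z = 0}"
  unfolding cpoly_def by (intro poly_roots_finite) (simp add: map_poly_eq_0_iff)

lemma isCont_cpoly: "isCont (cpoly p) z"
  unfolding cpoly_def by (intro continuous_intros)

lemma eventually_cpoly_nonzero:
  assumes "p \<noteq> 0"
  shows "eventually (\<lambda>w. cpoly p w \<noteq> 0) (at z)"
  using islimpt_finite[OF finite_cpoly_roots[OF assms], of z]
  by (simp add: islimpt_iff_eventually)

text \<open>
  By a Bezout identity the reduced numerator cannot vanish at a zero of the reduced denominator, so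
  such a zero is a genuine pole of \<open>A / B\<close>.  The original fraction agrees with \<open>A / B\<close> off the zeros of
  \<open>Q\<close>, hence in a punctured neighbourhood, and therefore has a pole there too.
\<close>

lemma pole_free_reduced_fraction:
  assumes "Q \<noteq> 0"
    and "\<And>z. norm z \<le> 1 \<Longrightarrow> \<not> is_pole (\<lambda>w. cpoly P w / cpoly Q w) z"
  obtains A B G where "P = A * G" "Q = B * G"
    "\<And>z. norm z \<le> 1 \<Longrightarrow> cpoly B z \<noteq> 0"
proof -
  obtain A B where AB: "P = A * gcd P Q" "Q = B * gcd P Q" "coprime A B"
    using gcd_coprime_exists[of P Q] assms(1) by auto
  obtain u v where uv: "u * A + v * B = 1"
    using bezout_coefficients_fst_snd[of A B] AB(3) by (metis coprime_imp_gcd_eq_1)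
  have B0: "B \<noteq> 0"
    using AB(2) assms(1) by auto
  have "cpoly B z \<noteq> 0" if z: "norm z \<le> 1" for z
  proof
    assume Bz: "cpoly B z = 0"
    have "cpoly (u * A + v * B) z = 1"
      unfolding uv by (simp add: cpoly_def)
    then have "cpoly A z \<noteq> 0"
      using Bz by (auto simp: cpoly_add cpoly_mult)
    moreover have "filterlim (cpoly B) (at 0) (at z)"
      using isCont_cpoly[of z B] Bz eventually_cpoly_nonzero[OF B0]
      by (auto simp: filterlim_at isCont_def)
    ultimately have "is_pole (\<lambda>w. cpoly A w / cpoly B w) z"
      by (intro is_pole_divide isCont_cpoly)
    moreover have "eventually (\<lambda>w. cpoly A w / cpoly B w = cpoly P w / cpoly Q w) (at z)"
      using eventually_cpoly_nonzero[OF assms(1)]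
    proof eventually_elim
      case (elim w)
      then show ?case
        using AB(1,2) by (metis cpoly_mult mult_divide_mult_cancel_right mult_zero_right)
    qed
    ultimately show False
      using assms(2)[OF z] is_pole_cong[OF _ refl] by metis
  qed
  then show ?thesis
    using that AB(1,2) by blast
qed

text \<open>
  A denominator without zeros in the closed disc has none in a slightly larger disc, so the fraction is
  holomorphic there and its expansion \<open>H\<close> at the origin converges beyond the unit circle.
\<close>

lemma power_series_of_fraction:
  assumes "fps_of_poly B * H = fps_of_poly A"
    and "\<And>z. norm z \<le> 1 \<Longrightarrow> cpoly B z \<noteq> 0"
  shows "fps_conv_radius (cfps H) > 1"
    and "norm z \<le> 1 \<Longrightarrow> eval_fps (cfps H) z = cpoly A z / cpoly B z"
proof -
  define A' B' where "A' = fps_of_poly (map_poly complex_of_real A)"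
    and "B' = fps_of_poly (map_poly complex_of_real B)"
  have evA: "eval_fps A' w = cpoly A w" and evB: "eval_fps B' w = cpoly B w" for w
    by (simp_all add: A'_def B'_def cpoly_def)
  have "B' * cfps H = A'"
    using arg_cong[OF assms(1), of cfps] by (simp add: A'_def B'_def cfps_mult cfps_of_poly)
  moreover have B'0: "B' \<noteq> 0"
    using assms(2)[of 0] evB[of 0] by auto
  ultimately have H: "cfps H = A' / B'"
    by (metis nonzero_mult_div_cancel_left)
  have "B \<noteq> 0"
    using assms(2)[of 0] by (auto simp: cpoly_def)
  \<comment> \<open>The number 2 only makes the set nonempty when \<open>B\<close> has no zeros; any number above 1 would do.\<close>
  define r where "r = Min (insert 2 (norm ` {z. cpoly B z = 0}))"
  have fin: "finite (insert 2 (norm ` {z. cpoly B z = 0}))"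
    using finite_cpoly_roots[OF \<open>B \<noteq> 0\<close>] by simp
  have r: "r > 1"
    unfolding r_def using fin assms(2) by (subst Min_gr_iff) (auto simp: not_le[symmetric])
  have nz: "eval_fps B' w \<noteq> 0" if "w \<in> eball 0 (ereal r)" for w
  proof
    assume "eval_fps B' w = 0"
    then have "r \<le> norm w"
      unfolding r_def using fin by (intro Min_le) (auto simp: evB)
    then show False using that by simp
  qed
  have rad: "fps_conv_radius A' = \<infinity>" "fps_conv_radius B' = \<infinity>"
    by (simp_all add: A'_def B'_def)
  have "fps_conv_radius (A' / B') \<ge> Min {ereal r, fps_conv_radius A', fps_conv_radius B'}"
    using r nz rad by (intro fps_conv_radius_divide') auto
  then have R: "fps_conv_radius (cfps H) \<ge> ereal r"
    by (simp add: H rad)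
  show "fps_conv_radius (cfps H) > 1"
    using r by (intro less_le_trans[OF _ R]) simp
  show "eval_fps (cfps H) z = cpoly A z / cpoly B z" if "norm z \<le> 1"
  proof -
    have "eval_fps (A' / B') z = eval_fps A' z / eval_fps B' z"
      using r nz rad that by (intro eval_fps_divide'[where r = "ereal r"]) (auto intro: le_less_trans)
    then show ?thesis by (simp add: H evA evB)
  qed
qed

section \<open>Trigonometric quotients\<close>

text \<open>
  Points of the circle are hit only discretely by \<open>cis\<close>; thus the finitely many zeros of \<open>Q\<close> do not
  interfere with limits of quotients along the circle.
\<close>

lemma eventually_cis_neq: "eventually (\<lambda>y. cis y \<noteq> w) (at x)"
proof (cases "cis x = w")
  case False
  have "(cis \<longlongrightarrow> cis x) (at x)"
    by (rule tendsto_cis) (rule tendsto_ident_at)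
  then show ?thesis
    using False by (rule tendsto_imp_eventually_ne)
next
  case True
  have "cis y \<noteq> w" if "y \<noteq> x" "dist y x < 2 * pi" for y
  proof
    assume "cis y = w"
    then have "sin y = sin x \<and> cos y = cos x"
      using True by (auto simp: complex_eq_iff)
    then obtain i :: int where i: "y = x + 2 * pi * i"
      using sin_cos_eq_iff by blast
    then have "\<bar>real_of_int i\<bar> < 1"
      using that by (simp add: dist_real_def abs_mult)
    then show False using i that by auto
  qed
  then show ?thesis
    unfolding eventually_at using pi_gt_zero by (intro exI[of _ "2 * pi"]) auto
qed

lemma eventually_cpoly_cis_nonzero:
  assumes "p \<noteq> 0"
  shows "eventually (\<lambda>y. cpoly p (cis y) \<noteq> 0) (at x)"
proof -
  have "eventually (\<lambda>y. \<forall>w\<in>{z. cpoly p z = 0}. cis y \<noteq> w) (at x)"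
    using finite_cpoly_roots[OF assms] by (intro eventually_ball_finite) (auto intro: eventually_cis_neq)
  then show ?thesis
    by eventually_elim auto
qed

lemma Im_mult_cnj_div_norm:
  fixes p q :: complex
  assumes "q \<noteq> 0"
  shows "Im (p * cnj q) / Re (q * cnj q) = Im (p / q)"
  by (simp add: Im_divide complex_mult_cnj power2_eq_square)

text \<open>
  Away from the zeros of \<open>Q\<close> the trigonometric quotient is \<open>Im (A / B)\<close>, which is continuous wherever
  \<open>B\<close> is nonzero: the common factor \<open>G\<close> accounts for exactly the removable singularities.
\<close>

lemma tendsto_trig_quotient:
  assumes "P = A * G" "Q = B * G" "Q \<noteq> 0" "cpoly B (cis x) \<noteq> 0"
  defines "Pt \<equiv> \<lambda>x. Im (cpoly P (cis x) * cnj (cpoly Q (cis x)))"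
    and "Qt \<equiv> \<lambda>x. Re (cpoly Q (cis x) * cnj (cpoly Q (cis x)))"
  shows "((\<lambda>y. Pt y / Qt y) \<longlongrightarrow> Im (cpoly A (cis x) / cpoly B (cis x))) (at x)"
proof -
  have "(cis \<longlongrightarrow> cis x) (at x)"
    by (rule tendsto_cis) (rule tendsto_ident_at)
  then have "((\<lambda>y. Im (cpoly A (cis y) / cpoly B (cis y)))
      \<longlongrightarrow> Im (cpoly A (cis x) / cpoly B (cis x))) (at x)"
    using assms(4) by (intro tendsto_intros isCont_tendsto_compose[OF isCont_cpoly])
  moreover have "eventually (\<lambda>y. Im (cpoly A (cis y) / cpoly B (cis y)) = Pt y / Qt y) (at x)"
    using eventually_cpoly_cis_nonzero[OF \<open>Q \<noteq> 0\<close>]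
  proof eventually_elim
    case (elim y)
    then have "Pt y / Qt y = Im (cpoly P (cis y) / cpoly Q (cis y))"
      unfolding Pt_def Qt_def by (rule Im_mult_cnj_div_norm)
    also have "cpoly P (cis y) / cpoly Q (cis y) = cpoly A (cis y) / cpoly B (cis y)"
      using elim by (simp add: assms(1,2) cpoly_mult)
    finally show ?case by simp
  qed
  ultimately show ?thesis
    by (rule Lim_transform_eventually)
qed

lemma Im_eval_cfps_cis:
  assumes "fps_conv_radius F > 1"
  shows "(\<lambda>l. fps_nth F l * sin (real l * x)) sums Im (eval_fps (cfps F) (cis x))"
proof -
  have "(\<lambda>l. fps_nth (cfps F) l * cis x ^ l) sums eval_fps (cfps F) (cis x)"
    using assms by (intro sums_eval_fps) (simp add: one_ereal_def)
  from sums_Im[OF this] show ?thesis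
    by (simp add: Complex.DeMoivre)
qed

lemma sine_system_eq:
  assumes "fps_conv_radius (power_system b j) > 1"
  shows "sine_system b j x = Im (eval_fps (cfps (power_system b j)) (cis x))"
proof -
  have "(\<lambda>l. fps_nth (power_system b j) l * sin (real l * x)) sums
      Im (eval_fps (cfps (power_system b j)) (cis x))"
    using assms by (rule Im_eval_cfps_cis)
  then have "(\<lambda>l. b j (Suc l) * sin (real (Suc l) * x)) sums
      Im (eval_fps (cfps (power_system b j)) (cis x))"
    using sums_Suc_iff[of "\<lambda>l. fps_nth (power_system b j) l * sin (real l * x)"]
    by (simp add: power_system_def)
  then show ?thesis
    by (simp add: sine_system_def sums_iff)
qed

text \<open>
  The coefficients of the formal remainder \<open>E\<close> are those of the sine series.  Its radius of convergence
  exceeds 1 because it is the difference of the given series and the expansion of \<open>A / B\<close>.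
\<close>

lemma sine_remainder:
  assumes HJ: "hermite_jacobi k n m (power_system b) P Q" and j: "j \<in> {1..k}"
    and rad: "fps_conv_radius (power_system b j) > 1"
    and pole: "\<And>z. norm z \<le> 1 \<Longrightarrow> \<not> is_pole (\<lambda>w. cpoly (P j) w / cpoly Q w) z"
  defines "Pt \<equiv> \<lambda>x. Im (cpoly (P j) (cis x) * cnj (cpoly Q (cis x)))"
    and "Qt \<equiv> \<lambda>x. Re (cpoly Q (cis x) * cnj (cpoly Q (cis x)))"
  shows "trig_regular Pt Qt x"
    and "\<exists>d. \<forall>x. (\<lambda>i. let l = n + mi_total k m + 1 + i in d l * sin (real l * x))
                 sums (sine_system b j x - trig_quot Pt Qt x)"
proof -
  define N where "N = n + mi_total k m + 1"
  define f where "f = power_system b j"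
  have Q0: "Q \<noteq> 0"
    using HJ by (simp add: hermite_jacobi_def)
  obtain E where E: "\<And>i. i < N \<Longrightarrow> fps_nth E i = 0" "fps_of_poly Q * (f - E) = fps_of_poly (P j)"
    using hermite_jacobi_remainder[OF HJ j] unfolding N_def f_def by metis
  obtain A B G where red: "P j = A * G" "Q = B * G" "\<And>z. norm z \<le> 1 \<Longrightarrow> cpoly B z \<noteq> 0"
    using pole_free_reduced_fraction[OF Q0 pole] by metis
  have lim: "((\<lambda>y. Pt y / Qt y) \<longlongrightarrow> Im (cpoly A (cis x) / cpoly B (cis x))) (at x)" for x
    unfolding Pt_def Qt_def using red Q0 by (intro tendsto_trig_quotient) auto
  then show "trig_regular Pt Qt x"
    unfolding trig_regular_def by blast
  have quot: "trig_quot Pt Qt x = Im (cpoly A (cis x) / cpoly B (cis x))" for x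
    unfolding trig_quot_def using lim by (intro tendsto_Lim) auto
  have G0: "fps_of_poly G \<noteq> 0"
    using red(2) Q0 fps_of_poly_eq_iff[of G 0] by auto
  have "fps_of_poly G * (fps_of_poly B * (f - E)) = fps_of_poly G * fps_of_poly A"
    using E(2) unfolding red(1,2) by (simp add: fps_of_poly_mult mult_ac)
  then have H: "fps_of_poly B * (f - E) = fps_of_poly A"
    using G0 by simp
  note H' = power_series_of_fraction[OF H red(3)]
  \<comment> \<open>By \<open>H\<close>, the series \<open>f - E\<close> is the expansion of \<open>A / B\<close>.\<close>
  have "fps_conv_radius (f - (f - E)) > 1"
    using fps_conv_radius_diff[of f "f - E"] rad H'(1) unfolding f_def[symmetric]
    by (simp add: min_def split: if_splits)
  then have radE: "fps_conv_radius E > 1"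
    by simp
  have "(\<lambda>i. let l = N + i in fps_nth E l * sin (real l * x))
      sums (sine_system b j x - trig_quot Pt Qt x)" for x
  proof -
    have "eval_fps (cfps (f - E)) (cis x) = eval_fps (cfps f) (cis x) - eval_fps (cfps E) (cis x)"
      unfolding cfps_diff using rad radE
      by (intro eval_fps_diff) (simp_all add: f_def one_ereal_def)
    then have "eval_fps (cfps E) (cis x) =
        eval_fps (cfps f) (cis x) - cpoly A (cis x) / cpoly B (cis x)"
      using H'(2)[of "cis x"] by simp
    then have "Im (eval_fps (cfps E) (cis x)) = sine_system b j x - trig_quot Pt Qt x"
      using rad by (simp only: quot sine_system_eq f_def minus_complex.sel)
    then have "(\<lambda>l. fps_nth E l * sin (real l * x)) sums (sine_system b j x - trig_quot Pt Qt x)"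
      using Im_eval_cfps_cis[OF radE, of x] by simp
    then have "(\<lambda>i. fps_nth E (i + N) * sin (real (i + N) * x))
        sums (sine_system b j x - trig_quot Pt Qt x)"
      using E(1) by (subst sums_zero_iff_shift) auto
    then show ?thesis
      by (simp add: Let_def add.commute)
  qed
  then show "\<exists>d. \<forall>x. (\<lambda>i. let l = n + mi_total k m + 1 + i in d l * sin (real l * x))
                 sums (sine_system b j x - trig_quot Pt Qt x)"
    unfolding N_def by (intro exI[of _ "fps_nth E"]) auto
qed

section \<open>Transfer to trigonometric approximations\<close>

theorem theorem2:
  fixes k n :: nat and m :: "nat \<Rightarrow> nat" and b :: "nat \<Rightarrow> nat \<Rightarrow> real"
    and P :: "nat \<Rightarrow> real poly" and Q :: "real poly"
  assumes "k \<ge> 1"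
    and "mi_total k m \<noteq> 0"
    and "n \<ge> Max (m ` {1..k})"
    and "\<And>j x. j \<in> {1..k} \<Longrightarrow> x \<in> {-1..1} \<Longrightarrow>
           summable (\<lambda>l. b j (Suc l) * poly (cheb_U (Suc l)) x)"
    and "hermite_jacobi k n m (power_system b) P Q"
    and "\<And>j. j \<in> {1..k} \<Longrightarrow> fps_conv_radius (power_system b j) > 1"
    and "\<And>j z. j \<in> {1..k} \<Longrightarrow> norm z \<le> 1 \<Longrightarrow> \<not> is_pole (\<lambda>w. cpoly (P j) w / cpoly Q w) z"
  shows "\<exists>Pt Qt. trig_hermite_jacobi k n m (sine_system b) Pt Qt \<and>
           (\<exists>q. \<forall>x. complex_of_real (Qt x) = cpoly Q (cis x) * cnj (cpoly Q (cis x)) \<and>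
                    Qt x = (\<Sum>l=0..mi_total k m. q l * cos (real l * x))) \<and>
           (\<forall>j\<in>{1..k}.
              (\<exists>p. \<forall>x. Pt j x = Im (cpoly (P j) (cis x) * cnj (cpoly Q (cis x))) \<and>
                       Pt j x = (\<Sum>l=0..num_degree k n m j. p l * sin (real l * x))) \<and>
              (\<exists>d. \<forall>x. (\<lambda>i. let l = n + mi_total k m + 1 + i in d l * sin (real l * x))
                         sums (sine_system b j x - trig_quot (Pt j) Qt x)))"
proof -
  define Pt where "Pt = (\<lambda>j x. Im (cpoly (P j) (cis x) * cnj (cpoly Q (cis x))))"
  define Qt where "Qt = (\<lambda>x. Re (cpoly Q (cis x) * cnj (cpoly Q (cis x))))"
  have degQ: "degree Q \<le> mi_total k m" and Q0: "Q \<noteq> 0"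
    and degP: "\<And>j. j \<in> {1..k} \<Longrightarrow> degree (P j) \<le> num_degree k n m j"
    using assms(5) by (auto simp: hermite_jacobi_def)
  \<comment> \<open>This is where \<open>n \<ge> max m\<^sub>j\<close> is used: it bounds the folded frequencies of \<open>P\<^sub>j cnj Q\<close>.\<close>
  have degQ': "degree Q \<le> num_degree k n m j" if "j \<in> {1..k}" for j
  proof -
    have "m j \<le> n"
      using assms(3) that by (meson Max_ge finite_atLeastAtMost finite_imageI image_eqI order_trans)
    then show ?thesis
      using degQ by (simp add: num_degree_def)
  qed
  have Qt: "complex_of_real (Qt x) = cpoly Q (cis x) * cnj (cpoly Q (cis x))" for x
    by (simp add: Qt_def complex_mult_cnj)
  obtain q where q: "\<And>x. Qt x = (\<Sum>l=0..mi_total k m. q l * cos (real l * x))"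
    using Re_cpoly_mult_cnj_cosine_polynomial[OF degQ degQ] unfolding Qt_def by blast
  have p: "\<exists>p. \<forall>x. Pt j x = (\<Sum>l=0..num_degree k n m j. p l * sin (real l * x))"
    if "j \<in> {1..k}" for j
    unfolding Pt_def using that by (intro Im_cpoly_mult_cnj_sine_polynomial degP degQ')
  have reg: "trig_regular (Pt j) Qt x" 
    and d: "\<exists>d. \<forall>x. (\<lambda>i. let l = n + mi_total k m + 1 + i in d l * sin (real l * x))
                    sums (sine_system b j x - trig_quot (Pt j) Qt x)"
    if "j \<in> {1..k}" for j x
    unfolding Pt_def Qt_def
    using sine_remainder[OF assms(5) that assms(6)[OF that] assms(7)[OF that]] by blast+
  have "\<exists>x. Qt x \<noteq> 0"
  proof -
    obtain x where "cpoly Q (cis x) \<noteq> 0"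
      using eventually_happens[OF eventually_cpoly_cis_nonzero[OF Q0, of 0]] by auto
    then have "complex_of_real (Qt x) \<noteq> 0"
      unfolding Qt by simp
    then show ?thesis by auto
  qed
  moreover have "trig_poly (mi_total k m) Qt"
    unfolding trig_poly_def by (intro exI[of _ q] exI[of _ "\<lambda>_. 0"]) (simp add: q)
  moreover have "trig_poly (num_degree k n m j) (Pt j)" if "j \<in> {1..k}" for j
  proof -
    obtain p where "\<And>x. Pt j x = (\<Sum>l=0..num_degree k n m j. p l * sin (real l * x))"
      using p[OF \<open>j \<in> {1..k}\<close>] by blast
    then show ?thesis
      unfolding trig_poly_def by (intro exI[of _ "\<lambda>_. 0"] exI[of _ p]) simp
  qed
  moreover have "\<exists>a c. \<forall>x. (\<lambda>i. let l = n + mi_total k m + 1 + i in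
                         a l * cos (real l * x) + c l * sin (real l * x))
                     sums (sine_system b j x - trig_quot (Pt j) Qt x)" if j: "j \<in> {1..k}" for j
  proof -
    obtain d where "\<forall>x. (\<lambda>i. let l = n + mi_total k m + 1 + i in d l * sin (real l * x))
                    sums (sine_system b j x - trig_quot (Pt j) Qt x)"
      using d[OF j] by blast
    then show ?thesis
      by (intro exI[of _ "\<lambda>_. 0"] exI[of _ d]) simp
  qed
  ultimately have "trig_hermite_jacobi k n m (sine_system b) Pt Qt"
    unfolding trig_hermite_jacobi_def using reg by blast
  moreover have "\<exists>q. \<forall>x. complex_of_real (Qt x) = cpoly Q (cis x) * cnj (cpoly Q (cis x)) \<and>
                    Qt x = (\<Sum>l=0..mi_total k m. q l * cos (real l * x))"
    using Qt q by blast
  moreover have "\<exists>p. \<forall>x. Pt j x = Im (cpoly (P j) (cis x) * cnj (cpoly Q (cis x))) \<and>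
                       Pt j x = (\<Sum>l=0..num_degree k n m j. p l * sin (real l * x))"
    if "j \<in> {1..k}" for j
    using p[OF that] by (simp add: Pt_def)
  ultimately show ?thesis
    using d by blast
qed

end
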